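(* Let $\mathcal{M},\mathcal{N}$ be $n$-outcome measurements on a $d$-dimensional Hilbert space $\mathcal{H}_d$ with POVMs $\{M_j\}$, $\{N_j\}$. For each $j$ let $Q_j$ be the largest projector with $Q_j\le M_j$ and $Q_j\le N_j$; the $Q_j$ are mutually orthogonal, so $P=\sum_jQ_j$ is a projector. Let $\widetilde{\mathcal{H}}=(I-P)\mathcal{H}_d$, and let $\widetilde{\mathcal{M}},\widetilde{\mathcal{N}}$ be the measurements on $\widetilde{\mathcal{H}}$ with POVM elements $\widetilde M_j=M_j-Q_j$ and $\widetilde N_j=N_j-Q_j$ (normalized to $I-P$). Suppose that $\mathcal{T}$ and $\widetilde{\mathcal{T}}$ are optimal solutions to discrimination with fixed failure rate $p_f=\widetilde p_f$ between the pairs of measurements $\mathcal{M},\mathcal{N}$ and $\widetilde{\mathcal{M}},\widetilde{\mathcal{N}}$, respectively. Then $p_s=\widetilde p_s$, or equivalently $p_e=\widetilde p_e$. Moreover, an optimal $\mathcal{T}$ can be chosen such that $\mathcal{T}|_{\widetilde{\mathcal{H}}}=\widetilde{\mathcal{T}}$, and vice versa, i.e. given an optimal $\mathcal{T}$, an optimal test $\widetilde{\mathcal{T}}$ can be chosen as $\widetilde{\mathcal{T}}=\mathcal{T}|_{\widetilde{\mathcal{H}}}$.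
   Context: An $n$-outcome measurement on a finite-dimensional complex Hilbert space is a POVM $\{M_j\}_{j=1}^n$: $M_j\ge 0$, $\sum_j M_j=I$. A (single-shot, general ancilla-assisted) test $\mathcal{T}$ on a Hilbert space $\mathcal{K}$ with conclusions $c\in\{\mathcal{M},\mathcal{N},f\}$ ($f$ = inconclusive) is a family of positive semidefinite operators $H^{(c)}_j$ on $\mathcal{K}$, $j=1,\dots,n$, with $\sum_c H^{(c)}_j=\rho$ for every $j$, where $\rho\ge0$, $\mathrm{tr}[\rho]=1$, is independent of $j$. The probability of conclusion $c$ when the tested measurement $\mathcal{A}$ has POVM $\{A_j\}$ is $p(c|\mathcal{A},\mathcal{T})=\sum_j \mathrm{tr}[H^{(c)}_jA_j]$. Given prior probabilities $\eta_{\mathcal M},\eta_{\mathcal N}\ge0$ with $\eta_{\mathcal M}+\eta_{\mathcal N}=1$, set $p_s=\eta_{\mathcal M}p(\mathcal M|\mathcal M,\mathcal T)+\eta_{\mathcal N}p(\mathcal N|\mathcal N,\mathcal T)$ (success), $p_e=\eta_{\mathcal M}p(\mathcal N|\mathcal M,\mathcal T)+\eta_{\mathcal N}p(\mathcal M|\mathcal N,\mathcal T)$ (error), $p_f=\eta_{\mathcal M}p(f|\mathcal M,\mathcal T)+\eta_{\mathcal N}p(f|\mathcal N,\mathcal T)$ (failure), so $p_s+p_e+p_f=1$. A test is an optimal solution to discrimination with fixed failure rate $p_f$ if it maximizes $p_s$ among all tests whose failure probability equals $p_f$. For $\widetilde{\mathcal M},\widetilde{\mathcal N}$ the same definitions are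 used on $\widetilde{\mathcal H}$ with the same prior probabilities, and the corresponding quantities are $\widetilde p_s,\widetilde p_e,\widetilde p_f$. For a test $\mathcal{T}$ on $\mathcal{H}_d$ with operators $H^{(c)}_j$ and normalization $\rho$, $\mathcal{T}|_{\widetilde{\mathcal{H}}}$ denotes its restriction to $\widetilde{\mathcal{H}}$, i.e. the test on $\widetilde{\mathcal{H}}$ with operators $(I-P)H^{(c)}_j(I-P)/(1-\lambda)$, where $\lambda=\mathrm{tr}[P\rho]$ (for $\lambda=0$ these are simply the operators $H^{(c)}_j$ regarded as acting on $\widetilde{\mathcal{H}}$).
   Formalization: The converse fails as written: the restriction of an optimal T can have another failure rate, and is undefined for λ=1. Proved: for λ≠1 it is optimal at its own rate, and at p_f if that rate is p_f (so if λ=0 or p_f=0); an optimal test at rate p_f exists on any nonzero reduced space. *)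

theory Defs
  imports "HOL-Analysis.Analysis"
begin

text \<open>
  The Hilbert space is \<open>complex ^ 'd\<close> with its standard inner product, and operators are
  matrices. A subspace is given by the orthogonal projector \<open>R\<close> onto it; operators acting on
  that subspace are the matrices \<open>A\<close> with \<open>R A R = A\<close>. The whole space is the
  case \<open>R = mat 1\<close>.
\<close>

type_synonym 'd cmat = "complex ^ 'd ^ 'd"

definition cinner :: "complex ^ 'd \<Rightarrow> complex ^ 'd \<Rightarrow> complex"
  where "cinner v w = (\<Sum>i\<in>UNIV. cnj (v $ i) * w $ i)"

definition adj :: "'d::finite cmat \<Rightarrow> 'd::finite cmat"
  where "adj A = (\<chi> i j. cnj (A $ j $ i))"

text \<open>Over the complex numbers the condition below already forces \<open>adj A = A\<close>.\<close>

definition psd :: "'d::finite cmat \<Rightarrow> bool"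
  where "psd A \<longleftrightarrow> (\<forall>v. cinner v (A *v v) \<in> \<real>\<^sub>\<ge>\<^sub>0)"

definition loewner_le :: "'d::finite cmat \<Rightarrow> 'd::finite cmat \<Rightarrow> bool"  (infix "\<preceq>" 50)
  where "A \<preceq> B \<longleftrightarrow> psd (B - A)"

definition projector :: "'d::finite cmat \<Rightarrow> bool"
  where "projector Q \<longleftrightarrow> adj Q = Q \<and> Q ** Q = Q"

definition largest_common_projector :: "'d::finite cmat \<Rightarrow> 'd::finite cmat \<Rightarrow> 'd::finite cmat \<Rightarrow> bool"
  where "largest_common_projector A B Q \<longleftrightarrow>
    projector Q \<and> Q \<preceq> A \<and> Q \<preceq> B \<and>
    (\<forall>Q'. projector Q' \<and> Q' \<preceq> A \<and> Q' \<preceq> B \<longrightarrow> Q' \<preceq> Q)"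

definition acts_on :: "'d::finite cmat \<Rightarrow> 'd::finite cmat \<Rightarrow> bool"
  where "acts_on R A \<longleftrightarrow> R ** A ** R = A"

definition povm :: "'d::finite cmat \<Rightarrow> ('n::finite \<Rightarrow> 'd::finite cmat) \<Rightarrow> bool"
  where "povm R A \<longleftrightarrow> (\<forall>j. psd (A j) \<and> acts_on R (A j)) \<and> (\<Sum>j\<in>UNIV. A j) = R"

datatype conclusion = Conc_M | Conc_N | Conc_fail

record ('n, 'd::finite) test =
  test_op :: "conclusion \<Rightarrow> 'n \<Rightarrow> complex ^ 'd ^ 'd"
  test_state :: "complex ^ 'd ^ 'd"

definition is_test :: "'d::finite cmat \<Rightarrow> ('n::finite, 'd) test \<Rightarrow> bool"
  where "is_test R T \<longleftrightarrow>
    (\<forall>c j. psd (test_op T c j) \<and> acts_on R (test_op T c j)) \<and>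
    psd (test_state T) \<and> acts_on R (test_state T) \<and> trace (test_state T) = 1 \<and>
    (\<forall>j. test_op T Conc_M j + test_op T Conc_N j + test_op T Conc_fail j = test_state T)"

text \<open>For positive semidefinite arguments the trace below is real, so \<open>Re\<close> only changes
  the type; likewise in \<open>overlap\<close>.\<close>

definition prob :: "conclusion \<Rightarrow> ('n::finite \<Rightarrow> 'd::finite cmat) \<Rightarrow> ('n, 'd) test \<Rightarrow> real"
  where "prob c A T = Re (\<Sum>j\<in>UNIV. trace (test_op T c j ** A j))"

definition p_success ::
  "real \<Rightarrow> real \<Rightarrow> ('n::finite \<Rightarrow> 'd::finite cmat) \<Rightarrow> ('n \<Rightarrow> 'd::finite cmat) \<Rightarrow> ('n, 'd) test \<Rightarrow> real"
  where "p_success \<eta>M \<eta>N M N T = \<eta>M * prob Conc_M M T + \<eta>N * prob Conc_N N T"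

definition p_error ::
  "real \<Rightarrow> real \<Rightarrow> ('n::finite \<Rightarrow> 'd::finite cmat) \<Rightarrow> ('n \<Rightarrow> 'd::finite cmat) \<Rightarrow> ('n, 'd) test \<Rightarrow> real"
  where "p_error \<eta>M \<eta>N M N T = \<eta>M * prob Conc_N M T + \<eta>N * prob Conc_M N T"

definition p_failure ::
  "real \<Rightarrow> real \<Rightarrow> ('n::finite \<Rightarrow> 'd::finite cmat) \<Rightarrow> ('n \<Rightarrow> 'd::finite cmat) \<Rightarrow> ('n, 'd) test \<Rightarrow> real"
  where "p_failure \<eta>M \<eta>N M N T = \<eta>M * prob Conc_fail M T + \<eta>N * prob Conc_fail N T"

definition optimal_test ::
  "'d::finite cmat \<Rightarrow> real \<Rightarrow> real \<Rightarrow> ('n::finite \<Rightarrow> 'd::finite cmat) \<Rightarrow> ('n \<Rightarrow> 'd::finite cmat) \<Rightarrow> real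
    \<Rightarrow> ('n, 'd) test \<Rightarrow> bool"
  where "optimal_test R \<eta>M \<eta>N M N pf T \<longleftrightarrow>
    is_test R T \<and> p_failure \<eta>M \<eta>N M N T = pf \<and>
    (\<forall>T'. is_test R T' \<and> p_failure \<eta>M \<eta>N M N T' = pf
      \<longrightarrow> p_success \<eta>M \<eta>N M N T' \<le> p_success \<eta>M \<eta>N M N T)"

definition overlap :: "'d::finite cmat \<Rightarrow> ('n, 'd) test \<Rightarrow> real"
  where "overlap P T = Re (trace (P ** test_state T))"

text \<open>The restriction to the range of \<open>mat 1 - P\<close> is meaningful only if
  \<open>overlap P T \<noteq> 1\<close>; otherwise division by zero turns every operator into 0, which
  is not a test.\<close>

definition restrict_test :: "'d::finite cmat \<Rightarrow> ('n, 'd) test \<Rightarrow> ('n, 'd) test"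
  where "restrict_test P T =
    \<lparr> test_op = (\<lambda>c j. (1 / (1 - overlap P T)) *\<^sub>R
        ((mat 1 - P) ** test_op T c j ** (mat 1 - P))),
      test_state = (1 / (1 - overlap P T)) *\<^sub>R
        ((mat 1 - P) ** test_state T ** (mat 1 - P)) \<rparr>"

end

theory Submission
  imports Defs
begin

text \<open>
  On the range of \<open>Q j\<close> both measurements give outcome \<open>j\<close> with certainty, so what a test does
  there is independent of the measurement: it reaches conclusion \<open>c\<close> with weight
  \<open>w c = prob c Q T\<close>, and these weights add up to \<open>overlap P T\<close>. Compress the operators of a test
  \<open>T\<close> to \<open>I - P\<close> and put the lost weight on an arbitrary state \<open>\<sigma>\<close> of the range of \<open>I - P\<close>,
  on which conclusion \<open>c\<close> is announced with probability \<open>w c\<close> whatever the outcome. The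
  resulting test for the reduced measurements has exactly the same success, error and failure
  probabilities as \<open>T\<close>. Conversely a test on the range of \<open>I - P\<close> is a test on the whole space with
  the same probabilities, so the two optimisation problems have equal values. If the
  restriction of an optimal \<open>T\<close> were not optimal for its own failure rate, a better test, scaled by
  \<open>1 - overlap P T\<close> and padded with the same weights, would beat \<open>T\<close>.
\<close>

subsection \<open>Matrices over the complex numbers\<close>

lemma mat_mul_add_left: "((A :: 'a::semiring_1 ^ 'm ^ 'n) + B) ** C = A ** C + B ** C"
  by (vector matrix_matrix_mult_def sum.distrib[symmetric] distrib_right)

lemma mat_mul_diff_left: "((A :: 'a::ring_1 ^ 'm ^ 'n) - B) ** C = A ** C - B ** C"
  by (vector matrix_matrix_mult_def sum_subtractf[symmetric] left_diff_distrib)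

lemma mat_mul_diff_right: "(A :: 'a::ring_1 ^ 'm ^ 'n) ** (B - C) = A ** B - A ** C"
  by (vector matrix_matrix_mult_def sum_subtractf[symmetric] right_diff_distrib)

lemma mat_mul_zero_left [simp]: "(0 :: 'a::semiring_1 ^ 'm ^ 'n) ** C = 0"
  by (vector matrix_matrix_mult_def)

lemma mat_mul_zero_right [simp]: "(C :: 'a::semiring_1 ^ 'm ^ 'n) ** 0 = 0"
  by (vector matrix_matrix_mult_def)

lemma mat_mul_scaleR_left [simp]:
  "(r *\<^sub>R (A :: 'a::real_algebra_1 ^ 'm ^ 'n)) ** B = r *\<^sub>R (A ** B)"
  by (simp add: vec_eq_iff matrix_matrix_mult_def scaleR_sum_right)

lemma mat_mul_scaleR_right [simp]:
  "(A :: 'a::real_algebra_1 ^ 'm ^ 'n) ** (r *\<^sub>R B) = r *\<^sub>R (A ** B)"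
  by (simp add: vec_eq_iff matrix_matrix_mult_def scaleR_sum_right)

lemma mat_mul_sum_left: "(\<Sum>i\<in>S. (A i :: 'a::semiring_1 ^ 'm ^ 'n)) ** B = (\<Sum>i\<in>S. A i ** B)"
  by (induction S rule: infinite_finite_induct) (simp_all add: mat_mul_add_left)

lemma mat_mul_sum_right: "(A :: 'a::semiring_1 ^ 'm ^ 'n) ** (\<Sum>i\<in>S. B i) = (\<Sum>i\<in>S. A ** B i)"
  by (induction S rule: infinite_finite_induct) (simp_all add: matrix_add_ldistrib)

lemmas mat_mul_distrib = mat_mul_add_left matrix_add_ldistrib mat_mul_diff_left mat_mul_diff_right

lemma trace_scaleR [simp]:
  "trace (r *\<^sub>R (A :: 'a::real_algebra_1 ^ 'n ^ 'n)) = r *\<^sub>R trace A"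
  by (simp add: trace_def scaleR_sum_right)

lemma trace_zero [simp]: "trace (0 :: 'a::semiring_1 ^ 'n ^ 'n) = 0"
  by (simp add: trace_def)

lemma trace_sum: "trace (\<Sum>i\<in>S. A i) = (\<Sum>i\<in>S. trace (A i :: 'a::comm_semiring_1 ^ 'n ^ 'n))"
  by (induction S rule: infinite_finite_induct) (simp_all add: trace_add)

lemma adj_mult: "adj (A ** B) = adj B ** adj A"
  by (simp add: adj_def matrix_matrix_mult_def vec_eq_iff mult.commute)

lemma adj_add: "adj (A + B) = adj A + adj B"
  and adj_diff: "adj (A - B) = adj A - adj B"
  and adj_scaleR: "adj (r *\<^sub>R A) = r *\<^sub>R adj A"
  and adj_zero [simp]: "adj 0 = 0"
  by (simp_all add: adj_def vec_eq_iff)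

lemma adj_adj [simp]: "adj (adj A) = A"
  by (simp add: adj_def vec_eq_iff)

lemma adj_mat_1 [simp]: "adj (mat 1) = mat 1"
  by (simp add: adj_def mat_def vec_eq_iff)

lemma adj_sum: "adj (\<Sum>i\<in>S. A i) = (\<Sum>i\<in>S. adj (A i))"
  by (induction S rule: infinite_finite_induct) (simp_all add: adj_add)

lemma cinner_add_left: "cinner (u + v) w = cinner u w + cinner v w"
  and cinner_add_right: "cinner w (u + v) = cinner w u + cinner w v"
  and cinner_diff_right: "cinner w (u - v) = cinner w u - cinner w v"
  by (simp_all add: cinner_def algebra_simps sum.distrib sum_subtractf)

lemma cinner_minus_right [simp]: "cinner w (- v) = - cinner w v"
  by (simp add: cinner_def sum_negf)

lemma cinner_smult_left: "cinner (c *s v) w = cnj c * cinner v w"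
  and cinner_smult_right: "cinner v (c *s w) = c * cinner v w"
  by (simp_all add: cinner_def sum_distrib_left algebra_simps)

lemma cinner_zero [simp]: "cinner v 0 = 0" "cinner 0 v = 0"
  by (simp_all add: cinner_def)

lemma cinner_scaleR_right: "cinner v (r *\<^sub>R w) = r *\<^sub>R cinner v w"
  by (simp add: cinner_def scaleR_sum_right)

lemma cinner_adj: "cinner v (A *v w) = cinner (adj A *v v) w"
proof -
  have "cinner v (A *v w) = (\<Sum>i\<in>UNIV. \<Sum>j\<in>UNIV. cnj (v $ i) * A $ i $ j * w $ j)"
    by (simp add: cinner_def matrix_vector_mult_def sum_distrib_left mult.assoc)
  also have "\<dots> = (\<Sum>j\<in>UNIV. \<Sum>i\<in>UNIV. cnj (v $ i) * A $ i $ j * w $ j)"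
    by (rule sum.swap)
  also have "\<dots> = cinner (adj A *v v) w"
    by (simp add: cinner_def matrix_vector_mult_def adj_def sum_distrib_right sum_distrib_left mult.commute
        mult.left_commute)
  finally show ?thesis .
qed

lemma cinner_self: "cinner v v = of_real (\<Sum>i\<in>UNIV. (cmod (v $ i))\<^sup>2)"
  unfolding cinner_def of_real_sum
  by (intro sum.cong refl) (metis complex_norm_square mult.commute)

lemma cinner_self_Re_pos: "v \<noteq> 0 \<Longrightarrow> Re (cinner v v) > 0"
  by (auto simp: cinner_self vec_eq_iff sum_nonneg_eq_0_iff sum_nonneg less_le)

lemma cinner_axis: "cinner (axis i 1) w = w $ i"
proof -
  have "cinner (axis i 1) w = (\<Sum>j\<in>UNIV. if j = i then w $ j else 0)"
    unfolding cinner_def axis_def by (intro sum.cong) auto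
  then show ?thesis by simp
qed

lemma cinner_axis_axis: "cinner (axis i 1) (A *v axis j 1) = A $ i $ j"
  by (simp only: cinner_axis) (simp add: matrix_vector_mult_def axis_def if_distrib[of "(*) _"] cong: if_cong)

subsection \<open>Positive semidefinite matrices\<close>

lemma psd_cinner: "psd A \<Longrightarrow> Re (cinner v (A *v v)) \<ge> 0" "psd A \<Longrightarrow> Im (cinner v (A *v v)) = 0"
  by (auto simp: psd_def complex_nonneg_Reals_iff)

lemma psdI:
  "(\<And>v. Re (cinner v (A *v v)) \<ge> 0) \<Longrightarrow> (\<And>v. Im (cinner v (A *v v)) = 0) \<Longrightarrow> psd A"
  by (auto simp: psd_def complex_nonneg_Reals_iff)

lemma psd_zero [simp]: "psd 0"
  by (simp add: psd_def)

lemma psd_add: "psd A \<Longrightarrow> psd B \<Longrightarrow> psd (A + B)"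
  by (simp add: psd_def matrix_vector_mult_add_rdistrib cinner_add_right)

lemma psd_scaleR: "psd A \<Longrightarrow> r \<ge> 0 \<Longrightarrow> psd (r *\<^sub>R A)"
proof -
  have "(r *\<^sub>R A) *v v = r *\<^sub>R (A *v v)" for v
    by (simp add: vec_eq_iff matrix_vector_mult_def scaleR_sum_right)
  then show "psd A \<Longrightarrow> r \<ge> 0 \<Longrightarrow> psd (r *\<^sub>R A)"
    by (auto intro!: psdI simp: cinner_scaleR_right psd_cinner)
qed

lemma psd_sum: "(\<And>i. i \<in> S \<Longrightarrow> psd (A i)) \<Longrightarrow> psd (\<Sum>i\<in>S. A i)"
  by (induction S rule: infinite_finite_induct) (auto intro: psd_add)

lemma psd_congruence: "psd A \<Longrightarrow> psd (adj S ** A ** S)"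
  unfolding psd_def
  by (metis adj_adj cinner_adj matrix_vector_mul_assoc)

lemma psd_mat_1: "psd (mat 1)"
  by (simp add: psd_def cinner_self sum_nonneg del: of_real_sum of_real_power)

lemma psd_projector: "projector Q \<Longrightarrow> psd Q"
  using psd_congruence[OF psd_mat_1, of Q] by (simp add: projector_def)

text \<open>Polarization: the form is real at \<open>axis i 1 + c *s axis j 1\<close> for every
  \<open>c\<close>. Taking \<open>c = 1\<close> compares the imaginary parts of the entries
  \<open>(i, j)\<close> and \<open>(j, i)\<close>, and \<open>c = \<i>\<close> their real
  parts.\<close>

lemma psd_hermitian:
  assumes "psd A"
  shows "adj A = A"
proof -
  have "A $ j $ i = cnj (A $ i $ j)" for i j
  proof -
    let ?s = "\<lambda>v w. cinner v (A *v w)"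
    let ?a = "axis i 1 :: complex ^ 'a" and ?b = "axis j 1 :: complex ^ 'a"
    have "Im (?s (?a + c *s ?b) (?a + c *s ?b)) = 0" for c
      using psd_cinner(2)[OF assms] by blast
    moreover have "?s (?a + c *s ?b) (?a + c *s ?b)
        = ?s ?a ?a + c * ?s ?a ?b + cnj c * ?s ?b ?a + cnj c * c * ?s ?b ?b" for c
      by (simp only: matrix_vector_right_distrib vector_scalar_commute cinner_add_left
          cinner_add_right cinner_smult_left cinner_smult_right) (simp add: algebra_simps)
    ultimately have "Im (?s ?a ?a + c * ?s ?a ?b + cnj c * ?s ?b ?a + cnj c * c * ?s ?b ?b) = 0" for c
      by metis
    note * = this[unfolded cinner_axis_axis]
    have "Im (A $ i $ j) + Im (A $ j $ i) = 0" "Re (A $ i $ j) - Re (A $ j $ i) = 0"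
      using *[of 1] *[of \<i>] psd_cinner(2)[OF assms, of ?a] psd_cinner(2)[OF assms, of ?b]
      by (simp_all add: cinner_axis_axis)
    then show ?thesis
      by (intro complex_eqI) simp_all
  qed
  then have "adj A $ i $ j = A $ i $ j" for i j
    unfolding adj_def vec_lambda_beta by (rule sym)
  then show ?thesis by (simp add: vec_eq_iff)
qed

text \<open>Perturb \<open>v\<close> along \<open>w = A *v v\<close>: the form at
  \<open>v + t w\<close> is \<open>2 t c + t^2 q\<close> with \<open>c\<close> the squared norm of
  \<open>w\<close>, which a small negative \<open>t\<close> would make negative if
  \<open>c > 0\<close>.\<close>

lemma psd_cinner_eq_0:
  assumes "psd A" and v: "Re (cinner v (A *v v)) = 0"
  shows "A *v v = 0"
proof (rule ccontr)
  define w where "w = A *v v"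
  assume "A *v v \<noteq> 0"
  then have pos: "Re (cinner w w) > 0"
    by (simp add: w_def cinner_self_Re_pos)
  define c q where "c = Re (cinner w w)" and "q = Re (cinner w (A *v w))"
  have q: "q \<ge> 0" by (simp add: q_def psd_cinner assms)
  \<comment> \<open>Dividing by \<open>q + 1\<close> instead of the minimizer's \<open>q\<close>
    also covers \<open>q = 0\<close>.\<close>
  define t where "t = - (c / (q + 1))"
  have vw: "cinner v (A *v w) = cinner w w"
    by (simp add: cinner_adj psd_hermitian[OF assms(1)] w_def)
  have "0 \<le> Re (cinner (v + of_real t *s w) (A *v (v + of_real t *s w)))"
    by (rule psd_cinner[OF assms(1)])
  also have "\<dots> = 2 * t * c + t\<^sup>2 * q"
    using v unfolding w_def[symmetric]
    by (simp add: matrix_vector_right_distrib vector_scalar_commute cinner_add_left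
        cinner_add_right cinner_smult_left cinner_smult_right vw w_def[symmetric]
        c_def q_def power2_eq_square algebra_simps)
  also have "\<dots> = (c / (q + 1)) * c * (q / (q + 1) - 2)"
    using q by (simp add: t_def divide_simps) (simp add: algebra_simps power2_eq_square)
  also have "\<dots> < 0"
    using q pos by (intro mult_pos_neg) (auto simp: c_def divide_simps)
  finally show False by simp
qed

text \<open>On the range of \<open>S\<close> the form of \<open>A\<close> is squeezed between 0 and
  that of \<open>B\<close>, which vanishes there. All algebraic relations between
  \<open>A j\<close>, \<open>Q j\<close> and \<open>P\<close> below rest on this.\<close>

lemma loewner_kernel:
  assumes "psd A" "A \<preceq> B" "B ** S = 0"
  shows "A ** S = 0"
proof -
  have "A *v (S *v x) = 0" for x
  proof (rule psd_cinner_eq_0[OF assms(1)])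
    have "B *v (S *v x) = 0"
      by (simp add: matrix_vector_mul_assoc assms)
    then have "Re (cinner (S *v x) (A *v (S *v x))) \<le> 0"
      using psd_cinner(1)[of "B - A" "S *v x"] assms(2)
      by (simp add: loewner_le_def matrix_vector_mult_diff_rdistrib cinner_diff_right)
    then show "Re (cinner (S *v x) (A *v (S *v x))) = 0"
      using psd_cinner(1)[OF assms(1)] by (simp add: order_antisym)
  qed
  then show ?thesis
    by (simp add: matrix_eq flip: matrix_vector_mul_assoc)
qed

lemma psd_diag: "psd A \<Longrightarrow> Re (A $ i $ i) \<ge> 0" "psd A \<Longrightarrow> Im (A $ i $ i) = 0"
  using psd_cinner[of A "axis i 1"] by (simp_all add: cinner_axis_axis)

lemma psd_trace_nonneg: "psd A \<Longrightarrow> Re (trace A) \<ge> 0"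
  by (simp add: trace_def psd_diag sum_nonneg)

lemma psd_diag_eq_0:
  assumes "psd A" "A $ i $ i = 0"
  shows "A $ j $ i = 0" "A $ i $ j = 0"
proof -
  have "A *v axis i 1 = 0"
    using assms by (intro psd_cinner_eq_0) (simp_all add: cinner_axis_axis)
  then show *: "A $ j $ i = 0" for j
    by (metis cinner_axis_axis cinner_zero(1))
  from *[of j] psd_hermitian[OF assms(1)] show "A $ i $ j = 0"
    by (simp add: adj_def vec_eq_iff) (metis complex_cnj_zero)
qed

text \<open>One step of Gaussian elimination \<open>A \<mapsto> A - A e\<^sub>i e\<^sub>i\<^sup>* A / a\<^sub>i\<^sub>i\<close> preserves positivity and kills a
  diagonal entry, so it writes \<open>A\<close> as a sum of rank-one terms without the spectral theorem.\<close>

lemma psd_trace_mult_nonneg: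
  assumes "psd A" "psd B"
  shows "Re (trace (A ** B)) \<ge> 0"
  using assms(1)
proof (induction "card {k. A $ k $ k \<noteq> 0}" arbitrary: A rule: less_induct)
  case less
  show ?case
  proof (cases "\<exists>i. A $ i $ i \<noteq> 0")
    case False
    then have "A $ k $ l = 0" for k l
      using psd_diag_eq_0(1)[OF less.prems, of l k] False by auto
    then have "A = 0" by (simp add: vec_eq_iff)
    then show ?thesis by simp
  next
    case True
    then obtain i where i: "A $ i $ i \<noteq> 0" by blast
    define a where "a = Re (A $ i $ i)"
    have aii: "A $ i $ i = of_real a"
      using psd_diag(2)[OF less.prems] by (simp add: a_def complex_eq_iff)
    have "a \<ge> 0"
      using psd_diag(1)[OF less.prems] by (simp add: a_def)
    moreover have "a \<noteq> 0"
      using i aii by auto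
    ultimately have "a > 0" by simp
    \<comment> \<open>\<open>E\<close> is the matrix unit at \<open>(i, i)\<close>, so
      \<open>A ** E ** A\<close> is the rank-one term of the elimination step.\<close>
    define E :: "'a cmat" where "E = (\<chi> k l. if k = i \<and> l = i then 1 else 0)"
    have E_right: "(X ** E) $ k $ l = (if l = i then X $ k $ i else 0)" for X :: "'a cmat" and k l
      by (simp add: matrix_matrix_mult_def E_def if_distrib[of "(*) _"] cong: if_cong)
    have E_left: "(E ** X) $ k $ l = (if k = i then X $ i $ l else 0)" for X :: "'a cmat" and k l
      by (simp add: matrix_matrix_mult_def E_def if_distrib[of "\<lambda>x. x * _"] cong: if_cong)
    have E_mult: "(X ** E ** Y) $ k $ l = X $ k $ i * Y $ i $ l" for X Y :: "'a cmat" and k l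
      by (simp add: matrix_matrix_mult_def[of "X ** E"] E_right if_distrib[of "\<lambda>x. x * _"] cong: if_cong)
    have adjE: "adj E = E" by (auto simp: adj_def E_def vec_eq_iff)
    have EAE: "E ** A ** E = a *\<^sub>R E"
      by (simp add: vec_eq_iff E_right E_left aii) (simp add: E_def scaleR_conv_of_real)
    \<comment> \<open>The elimination step is congruence by \<open>S\<close>: the cross terms
      contribute \<open>-2/a\<close> and the quadratic term \<open>+1/a\<close> times
      \<open>A ** E ** A\<close>.\<close>
    define S where "S = mat 1 - (1 / a) *\<^sub>R (E ** A)"
    define A' where "A' = A - (1 / a) *\<^sub>R (A ** E ** A)"
    have herm: "adj A = A" by (rule psd_hermitian[OF less.prems])
    have AEAEA: "A ** E ** A ** E ** A = a *\<^sub>R (A ** E ** A)"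
    proof -
      have "A ** E ** A ** E ** A = A ** (E ** A ** E) ** A" by (simp add: matrix_mul_assoc)
      then show ?thesis by (simp add: EAE)
    qed
    have "adj S ** A ** S = A'"
      using \<open>a > 0\<close>
      by (simp add: S_def A'_def adj_diff adj_scaleR adj_mult adjE herm mat_mul_distrib
          matrix_mul_assoc AEAEA)
    then have psd': "psd A'"
      using psd_congruence[OF less.prems, of S] by simp
    have entry: "A' $ k $ l = A $ k $ l - A $ k $ i * A $ i $ l / a" for k l
      by (simp add: A'_def E_mult) (simp add: scaleR_conv_of_real divide_simps)
    have "A' $ i $ i = 0"
      using \<open>a > 0\<close> by (simp add: entry aii)
    moreover have "A' $ k $ k = 0" if "A $ k $ k = 0" for k
      using psd_diag_eq_0[OF less.prems that] that by (simp add: entry)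
    \<comment> \<open>Vanishing diagonal entries stay zero and entry \<open>i\<close> joins them, so
      the induction measure drops.\<close>
    ultimately have "{k. A' $ k $ k \<noteq> 0} \<subset> {k. A $ k $ k \<noteq> 0}"
      using i by blast
    then have IH: "Re (trace (A' ** B)) \<ge> 0"
      by (intro less.hyps psd' psubset_card_mono) auto
    \<comment> \<open>Since \<open>E\<close> is idempotent, cyclicity identifies the trace of the
      rank-one term against \<open>B\<close> with that of a congruence of \<open>B\<close>.\<close>
    have "psd (adj (A ** E) ** B ** (A ** E))"
      by (rule psd_congruence[OF assms(2)])
    then have "Re (trace (E ** A ** B ** A ** E)) \<ge> 0"
      by (intro psd_trace_nonneg) (simp add: adj_mult adjE herm matrix_mul_assoc)
    also have "trace (E ** A ** B ** A ** E) = trace (E ** (E ** A ** B ** A))"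
      by (rule trace_mul_sym)
    also have "E ** (E ** A ** B ** A) = E ** A ** B ** A"
    proof -
      have "E ** E = E"
        by (simp add: vec_eq_iff E_right) (simp add: E_def)
      then show ?thesis by (simp add: matrix_mul_assoc)
    qed
    also have "trace (E ** A ** B ** A) = trace (A ** (E ** A ** B))"
      by (rule trace_mul_sym)
    finally have "Re (trace (A ** E ** A ** B)) \<ge> 0"
      by (simp add: matrix_mul_assoc)
    moreover have "A ** B = A' ** B + (1 / a) *\<^sub>R (A ** E ** A ** B)"
      by (simp add: A'_def mat_mul_diff_left)
    ultimately show ?thesis
      using IH \<open>a > 0\<close> by (simp add: trace_add)
  qed
qed

subsection \<open>Compression and padding of tests\<close>

lemma prob_diff: "prob c (\<lambda>j. A j - B j) T = prob c A T - prob c B T"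
  by (simp add: prob_def mat_mul_diff_right trace_sub sum_subtractf)

lemma prob_nonneg: "is_test R T \<Longrightarrow> (\<And>j. psd (A j)) \<Longrightarrow> prob c A T \<ge> 0"
  by (auto simp: prob_def is_test_def psd_trace_mult_nonneg intro!: sum_nonneg)

text \<open>The three operators add up to the same state for every outcome, so the sum over outcomes
  falls on \<open>A\<close> alone.\<close>

lemma sum_prob:
  assumes "is_test R T"
  shows "prob Conc_M A T + prob Conc_N A T + prob Conc_fail A T
    = Re (trace (test_state T ** (\<Sum>j\<in>UNIV. A j)))"
proof -
  have "test_op T Conc_M j ** A j + test_op T Conc_N j ** A j + test_op T Conc_fail j ** A j
      = test_state T ** A j" for j
    using assms by (simp add: is_test_def flip: mat_mul_add_left)
  then have "trace (test_op T Conc_M j ** A j) + trace (test_op T Conc_N j ** A j)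
      + trace (test_op T Conc_fail j ** A j) = trace (test_state T ** A j)" for j
    by (metis trace_add)
  then show ?thesis
    by (simp add: prob_def mat_mul_sum_right trace_sum flip: sum.distrib plus_complex.sel)
qed

lemma projector_complement: "projector P \<Longrightarrow> projector (mat 1 - P)"
  by (simp add: projector_def adj_diff mat_mul_distrib)

lemma psd_compress: "projector R \<Longrightarrow> psd A \<Longrightarrow> psd (R ** A ** R)"
  using psd_congruence[of A R] by (simp add: projector_def)

lemma acts_on_compress: "projector R \<Longrightarrow> acts_on R (R ** A ** R)"
  by (simp add: projector_def acts_on_def matrix_mul_assoc) (metis matrix_mul_assoc)

lemma trace_compress:
  assumes "projector R"
  shows "trace (R ** A ** R) = trace (R ** A)"
  using assms trace_mul_sym[of "R ** A" R] by (simp add: projector_def matrix_mul_assoc)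

text \<open>Cyclicity moves both factors \<open>R\<close> onto \<open>B\<close>, which absorbs them:
  effects on a subspace cannot detect compression of the test.\<close>

lemma trace_compress_mult:
  assumes "acts_on R B"
  shows "trace (R ** A ** R ** B) = trace (A ** B)"
proof -
  have "trace (R ** A ** R ** B) = trace (R ** (A ** R ** B))"
    by (simp add: matrix_mul_assoc)
  also have "\<dots> = trace (A ** (R ** B ** R))"
    by (subst trace_mul_sym) (simp add: matrix_mul_assoc)
  finally show ?thesis
    using assms by (simp add: acts_on_def)
qed

text \<open>With the failure rate fixed, this turns equality of success probabilities into equality
  of error probabilities.\<close>

lemma p_sum:
  assumes "is_test R T" "projector R" "povm R M" "povm R N" "\<eta>M + \<eta>N = 1"
  shows "p_success \<eta>M \<eta>N M N T + p_error \<eta>M \<eta>N M N T + p_failure \<eta>M \<eta>N M N T = 1"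
proof -
  have "trace (test_state T ** R) = 1"
    using assms(1,2) trace_mul_sym[of "test_state T" R] trace_compress[of R "test_state T"]
    by (simp add: is_test_def acts_on_def)
  then have "prob Conc_M A T + prob Conc_N A T + prob Conc_fail A T = 1" if "povm R A" for A
    using sum_prob[OF assms(1)] that by (simp add: povm_def)
  from this[OF assms(3)] this[OF assms(4)]
  have "\<eta>M * (prob Conc_M M T + prob Conc_N M T + prob Conc_fail M T)
      + \<eta>N * (prob Conc_M N T + prob Conc_N N T + prob Conc_fail N T) = 1"
    using assms(5) by simp
  then show ?thesis
    by (simp add: p_success_def p_error_def p_failure_def algebra_simps)
qed

lemma is_test_whole_space: "is_test R T \<Longrightarrow> is_test (mat 1) T"
  by (simp add: is_test_def acts_on_def)

lemma acts_on_complement: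
  assumes "projector P" "acts_on (mat 1 - P) A"
  shows "P ** A = 0" "A ** P = 0"
proof -
  have "P ** (mat 1 - P) = 0" "(mat 1 - P) ** P = 0"
    using assms(1) by (simp_all add: projector_def mat_mul_distrib)
  moreover have "A = (mat 1 - P) ** (A ** (mat 1 - P))" "A = (mat 1 - P) ** A ** (mat 1 - P)"
    using assms(2) by (simp_all add: acts_on_def matrix_mul_assoc)
  ultimately show "P ** A = 0" "A ** P = 0"
    by (metis matrix_mul_assoc mat_mul_zero_left, metis matrix_mul_assoc mat_mul_zero_right)
qed

lemma overlap_complement: "projector P \<Longrightarrow> is_test (mat 1 - P) T \<Longrightarrow> overlap P T = 0"
  by (simp add: overlap_def is_test_def acts_on_complement)

lemma trace_complement_state:
  assumes "projector P" "is_test (mat 1) T"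
  shows "trace ((mat 1 - P) ** test_state T ** (mat 1 - P)) = of_real (1 - overlap P T)"
proof -
  \<comment> \<open>\<open>overlap\<close> keeps only a real part; positivity of the compression
    shows that no imaginary part was lost.\<close>
  have "psd (P ** test_state T ** P)"
    using assms by (intro psd_compress) (auto simp: is_test_def)
  then have "Im (trace (P ** test_state T ** P)) = 0"
    by (simp add: trace_def psd_diag)
  then have "trace (P ** test_state T) = of_real (overlap P T)"
    using trace_compress[OF assms(1), of "test_state T"] by (simp add: overlap_def complex_eq_iff)
  then show ?thesis
    unfolding trace_compress[OF projector_complement[OF assms(1)]]
    using assms(2) by (simp add: mat_mul_diff_left trace_sub is_test_def)
qed

lemma overlap_le_1:
  assumes "projector P" "is_test (mat 1) T"
  shows "overlap P T \<le> 1"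
proof -
  have "psd ((mat 1 - P) ** test_state T ** (mat 1 - P))"
    using assms by (intro psd_compress projector_complement) (auto simp: is_test_def)
  then show ?thesis
    using psd_trace_nonneg by (fastforce simp: trace_complement_state[OF assms])
qed

definition is_state :: "'d::finite cmat \<Rightarrow> 'd cmat \<Rightarrow> bool"
  where "is_state R \<sigma> \<longleftrightarrow> psd \<sigma> \<and> acts_on R \<sigma> \<and> trace \<sigma> = 1"

text \<open>Normalize \<open>R\<close> itself: its trace is the sum of the squared moduli of its
  entries, hence positive.\<close>

lemma state_exists:
  assumes "projector R" "R \<noteq> 0"
  shows "\<exists>\<sigma>. is_state R \<sigma>"
proof -
  have "(adj R ** R) $ i $ i = cinner (column i R) (column i R)" for i
    by (simp add: matrix_matrix_mult_def adj_def cinner_def column_def)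
  then have "R $ i $ i = cinner (column i R) (column i R)" for i
    using assms(1) by (simp add: projector_def)
  then have tr: "trace R = of_real (\<Sum>i\<in>UNIV. \<Sum>k\<in>UNIV. (cmod (R $ k $ i))\<^sup>2)"
    by (simp add: trace_def cinner_self column_def)
  define t where "t = (\<Sum>i\<in>UNIV. \<Sum>k\<in>UNIV. (cmod (R $ k $ i))\<^sup>2)"
  have "t \<noteq> 0"
    using assms(2) by (auto simp: t_def sum_nonneg_eq_0_iff sum_nonneg vec_eq_iff)
  moreover have "t \<ge> 0"
    by (auto simp: t_def intro!: sum_nonneg)
  moreover have "trace ((1 / t) *\<^sub>R R) = 1"
    using tr \<open>t \<noteq> 0\<close> unfolding t_def[symmetric] by (simp only: trace_scaleR) (simp add: scaleR_conv_of_real)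
  ultimately have "is_state R ((1 / t) *\<^sub>R R)"
    using assms(1) psd_projector[OF assms(1)]
    by (simp add: is_state_def acts_on_def projector_def psd_scaleR)
  then show ?thesis ..
qed

text \<open>The state \<open>\<sigma>\<close> gives conclusion \<open>c\<close> with probability \<open>w c\<close>, whatever the outcome. With
  \<open>l = 1\<close> no division by \<open>1 - overlap P T\<close> occurs, so a test concentrated on the range of \<open>P\<close> is
  no special case.\<close>

definition pad_test ::
  "'d::finite cmat \<Rightarrow> real \<Rightarrow> (conclusion \<Rightarrow> real) \<Rightarrow> 'd cmat \<Rightarrow> ('n::finite, 'd) test \<Rightarrow> ('n, 'd) test"
  where "pad_test R l w \<sigma> T =
    \<lparr> test_op = (\<lambda>c j. l *\<^sub>R (R ** test_op T c j ** R) + w c *\<^sub>R \<sigma>),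
      test_state = l *\<^sub>R (R ** test_state T ** R)
        + (w Conc_M + w Conc_N + w Conc_fail) *\<^sub>R \<sigma> \<rparr>"

text \<open>Restriction is padding with zero weights, so the facts about padded tests cover it, with
  an arbitrary \<open>\<sigma>\<close>.\<close>

lemma restrict_test_eq_pad:
  "restrict_test P T = pad_test (mat 1 - P) (1 / (1 - overlap P T)) (\<lambda>_. 0) \<sigma> T"
  by (simp add: restrict_test_def pad_test_def)

lemma is_test_pad:
  assumes P: "projector P" and T: "is_test (mat 1) T" and \<sigma>: "is_state (mat 1 - P) \<sigma>"
    and nonneg: "l \<ge> 0" "\<And>c. w c \<ge> 0"
    and total: "l * (1 - overlap P T) + (w Conc_M + w Conc_N + w Conc_fail) = 1"
  shows "is_test (mat 1 - P) (pad_test (mat 1 - P) l w \<sigma> T)"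
proof -
  let ?R = "mat 1 - P"
  have R: "projector ?R" by (rule projector_complement[OF P])
  have psd: "psd (l *\<^sub>R (?R ** A ** ?R) + r *\<^sub>R \<sigma>)" if "psd A" "r \<ge> 0" for A r
    using that nonneg \<sigma> R by (auto simp: is_state_def intro!: psd_add psd_scaleR psd_compress)
  have acts: "acts_on ?R (l *\<^sub>R (?R ** A ** ?R) + r *\<^sub>R \<sigma>)" for A r
    using acts_on_compress[OF R, of A] \<sigma>
    by (simp add: acts_on_def is_state_def mat_mul_add_left matrix_add_ldistrib)
  have "trace (test_state (pad_test ?R l w \<sigma> T))
      = of_real (l * (1 - overlap P T) + (w Conc_M + w Conc_N + w Conc_fail))"
    using \<sigma> by (simp add: pad_test_def trace_add trace_complement_state[OF P T] is_state_def)
      (simp add: scaleR_conv_of_real)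
  moreover have "test_op (pad_test ?R l w \<sigma> T) Conc_M j + test_op (pad_test ?R l w \<sigma> T) Conc_N j
      + test_op (pad_test ?R l w \<sigma> T) Conc_fail j = test_state (pad_test ?R l w \<sigma> T)" for j
  proof -
    have "?R ** test_op T Conc_M j ** ?R + ?R ** test_op T Conc_N j ** ?R
        + ?R ** test_op T Conc_fail j ** ?R = ?R ** test_state T ** ?R"
      using T by (simp add: is_test_def flip: mat_mul_add_left matrix_add_ldistrib)
    from this[symmetric] show ?thesis
      by (simp add: pad_test_def scaleR_add_right scaleR_add_left)
  qed
  ultimately show ?thesis
    using T psd acts nonneg total by (auto simp: is_test_def pad_test_def)
qed

text \<open>The elements of \<open>A\<close> sum to \<open>R\<close>, on whose range
  \<open>\<sigma>\<close> has trace 1, so the padding contributes exactly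
  \<open>w c\<close>.\<close>

lemma prob_pad:
  assumes R: "projector R" and A: "povm R A" and \<sigma>: "is_state R \<sigma>"
  shows "prob c A (pad_test R l w \<sigma> T) = l * prob c A T + w c"
proof -
  have "(\<Sum>j\<in>UNIV. trace (\<sigma> ** A j)) = trace (\<sigma> ** R)"
    using A by (simp add: povm_def flip: trace_sum mat_mul_sum_right)
  also have "\<dots> = trace (R ** \<sigma> ** R)"
    by (simp add: trace_compress[OF R] trace_mul_sym[of \<sigma>])
  also have "\<dots> = 1"
    using \<sigma> by (simp add: is_state_def acts_on_def)
  finally have \<sigma>_sum: "Re (\<Sum>j\<in>UNIV. trace (\<sigma> ** A j)) = 1" by simp
  have "trace (test_op (pad_test R l w \<sigma> T) c j ** A j)
      = l *\<^sub>R trace (test_op T c j ** A j) + w c *\<^sub>R trace (\<sigma> ** A j)" for j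
    using A trace_compress_mult[where R = R and B = "A j"]
    by (simp add: pad_test_def mat_mul_add_left trace_add povm_def)
  then have "prob c A (pad_test R l w \<sigma> T)
      = Re (l *\<^sub>R (\<Sum>j\<in>UNIV. trace (test_op T c j ** A j)) + w c *\<^sub>R (\<Sum>j\<in>UNIV. trace (\<sigma> ** A j)))"
    by (simp only: prob_def sum.distrib scaleR_sum_right)
  then show ?thesis
    using \<sigma>_sum by (simp add: prob_def)
qed

subsection \<open>Projective parts of a measurement\<close>

text \<open>Set up for one measurement and interpreted for both \<open>M\<close> and
  \<open>N\<close> with the same \<open>Q\<close> and \<open>P\<close>.\<close>

locale projective_part =
  fixes A Q :: "'n::finite \<Rightarrow> 'd::finite cmat" and P :: "'d cmat"
  assumes povm_A: "povm (mat 1) A"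
    and projector_Q: "\<And>j. projector (Q j)"
    and Q_le_A: "\<And>j. Q j \<preceq> A j"
    and P_eq: "P = (\<Sum>j\<in>UNIV. Q j)"
begin

lemma psd_A: "psd (A j)"
  using povm_A by (simp add: povm_def)

lemma A_le_complement:
  assumes "i \<noteq> j"
  shows "A i \<preceq> mat 1 - A j"
proof -
  have "(\<Sum>k\<in>UNIV. A k) = (\<Sum>k\<in>UNIV - {i, j}. A k) + (\<Sum>k\<in>{i, j}. A k)"
    by (rule sum.subset_diff) auto
  then have "(\<Sum>k\<in>UNIV. A k) - A j - A i = (\<Sum>k\<in>UNIV - {i, j}. A k)"
    using assms by simp
  then have "mat 1 - A j - A i = (\<Sum>k\<in>UNIV - {i, j}. A k)"
    using povm_A by (simp add: povm_def)
  then show ?thesis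
    by (simp add: loewner_le_def psd_sum psd_A)
qed

text \<open>\<open>mat 1 - A j\<close> lies between 0 and \<open>mat 1 - Q j\<close>, which
  annihilates \<open>Q j\<close>: outcome \<open>j\<close> is certain on that range.\<close>

lemma A_Q: "A j ** Q j = Q j"
proof -
  have "mat 1 - A j = (\<Sum>k\<in>UNIV - {j}. A k)"
    using povm_A sum.remove[of UNIV j A] by (simp add: povm_def algebra_simps)
  then have "psd (mat 1 - A j)"
    by (simp add: psd_sum psd_A)
  moreover have "mat 1 - A j \<preceq> mat 1 - Q j"
    using Q_le_A[of j] by (simp add: loewner_le_def)
  moreover have "(mat 1 - Q j) ** Q j = 0"
    using projector_Q[of j] by (simp add: projector_def mat_mul_diff_left)
  ultimately have "(mat 1 - A j) ** Q j = 0"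
    by (rule loewner_kernel)
  then show ?thesis by (simp add: mat_mul_diff_left)
qed

lemma A_Q_other: "i \<noteq> j \<Longrightarrow> A i ** Q j = 0"
  using loewner_kernel[OF psd_A A_le_complement, of i j "Q j"] by (simp add: mat_mul_diff_left A_Q)

text \<open>\<open>Q i\<close> lies below \<open>A i\<close>, which annihilates
  \<open>Q j\<close>.\<close>

lemma Q_orthogonal: "i \<noteq> j \<Longrightarrow> Q i ** Q j = 0"
  using loewner_kernel[OF psd_projector[OF projector_Q] Q_le_A] A_Q_other by blast

lemma adj_Q: "adj (Q j) = Q j" and Q_idem: "Q j ** Q j = Q j"
  using projector_Q[of j] by (simp_all add: projector_def)

lemma Q_P: "Q j ** P = Q j"
proof -
  have "(\<Sum>i\<in>UNIV. Q j ** Q i) = (\<Sum>i\<in>UNIV. if i = j then Q j else 0)"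
    by (intro sum.cong) (auto simp: Q_orthogonal Q_idem)
  then show ?thesis by (simp add: P_eq mat_mul_sum_right)
qed

lemma A_P: "A j ** P = Q j"
proof -
  have "(\<Sum>i\<in>UNIV. A j ** Q i) = (\<Sum>i\<in>UNIV. if i = j then Q j else 0)"
    by (intro sum.cong) (auto simp: A_Q_other A_Q)
  then show ?thesis by (simp add: P_eq mat_mul_sum_right)
qed

lemma projector_P: "projector P"
proof -
  have "P ** P = (\<Sum>j\<in>UNIV. Q j ** P)"
    by (subst P_eq) (simp add: mat_mul_sum_left)
  then show ?thesis
    by (simp add: projector_def Q_P flip: P_eq) (simp add: P_eq adj_sum adj_Q)
qed

lemma P_Q: "P ** Q j = Q j"
  using arg_cong[OF Q_P, of adj j] projector_P by (simp add: adj_mult adj_Q projector_def)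

lemma P_A: "P ** A j = Q j"
  using arg_cong[OF A_P, of adj j] projector_P psd_hermitian[OF psd_A]
  by (simp add: adj_mult adj_Q projector_def)

lemma povm_remainder: "povm (mat 1 - P) (\<lambda>j. A j - Q j)"
proof -
  have "acts_on (mat 1 - P) (A j - Q j)" for j
    by (simp add: acts_on_def mat_mul_distrib P_A P_Q A_P Q_P)
  moreover have "(\<Sum>j\<in>UNIV. A j - Q j) = mat 1 - P"
    using povm_A by (simp add: povm_def sum_subtractf P_eq)
  ultimately show ?thesis
    using Q_le_A by (simp add: povm_def loewner_le_def)
qed

lemma prob_Q_nonneg: "is_test R T \<Longrightarrow> prob c Q T \<ge> 0"
  by (simp add: prob_nonneg psd_projector projector_Q)

lemma sum_prob_Q:
  "is_test R T \<Longrightarrow> prob Conc_M Q T + prob Conc_N Q T + prob Conc_fail Q T = overlap P T"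
  by (simp add: sum_prob overlap_def trace_mul_sym[of "test_state T"] flip: P_eq)

lemma prob_Q_complement:
  assumes "is_test (mat 1 - P) T"
  shows "prob c Q T = 0"
proof -
  have "test_op T c j ** Q j = 0" for j
    using acts_on_complement(2)[OF projector_P, of "test_op T c j"] assms
    by (metis P_Q is_test_def mat_mul_zero_left matrix_mul_assoc)
  then show ?thesis by (simp add: prob_def)
qed

end

text \<open>Restricting an optimal test may change its failure rate, because part of the failures
  may come from the range of \<open>P\<close>. Optimality of the restriction is therefore claimed at
  its own rate, and at \<open>pf\<close> in the cases where the two rates agree. At rate
  \<open>pf\<close> an optimal reduced test always exists if \<open>P \<noteq> mat 1\<close>; for
  \<open>P = mat 1\<close> the reduced space is zero and carries no test.\<close>

theorem theorem2:
  fixes M N Q Mt Nt :: "'n::finite \<Rightarrow> complex ^ 'd::finite ^ 'd"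
    and P :: "complex ^ 'd ^ 'd"
    and \<eta>M \<eta>N :: real
  assumes povm_M: "povm (mat 1) M"
    and povm_N: "povm (mat 1) N"
    and priors: "\<eta>M \<ge> 0" "\<eta>N \<ge> 0" "\<eta>M + \<eta>N = 1"
    and Q: "\<And>j. largest_common_projector (M j) (N j) (Q j)"
    and P: "P = (\<Sum>j\<in>UNIV. Q j)"
    and Mt: "\<And>j. Mt j = M j - Q j"
    and Nt: "\<And>j. Nt j = N j - Q j"
  shows
    "(\<forall>i j. i \<noteq> j \<longrightarrow> Q i ** Q j = 0) \<and> projector P \<and>
     povm (mat 1 - P) Mt \<and> povm (mat 1 - P) Nt \<and>
     (\<forall>pf T Tt.
        optimal_test (mat 1) \<eta>M \<eta>N M N pf T \<and>
        optimal_test (mat 1 - P) \<eta>M \<eta>N Mt Nt pf Tt \<longrightarrow>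
          p_success \<eta>M \<eta>N M N T = p_success \<eta>M \<eta>N Mt Nt Tt \<and>
          p_error \<eta>M \<eta>N M N T = p_error \<eta>M \<eta>N Mt Nt Tt) \<and>
     (\<forall>pf Tt.
        optimal_test (mat 1 - P) \<eta>M \<eta>N Mt Nt pf Tt \<longrightarrow>
          (\<exists>T. optimal_test (mat 1) \<eta>M \<eta>N M N pf T \<and>
               overlap P T \<noteq> 1 \<and> restrict_test P T = Tt)) \<and>
     (\<forall>pf T.
        optimal_test (mat 1) \<eta>M \<eta>N M N pf T \<longrightarrow>
          (P \<noteq> mat 1 \<longrightarrow>
             (\<exists>Tt. optimal_test (mat 1 - P) \<eta>M \<eta>N Mt Nt pf Tt)) \<and>
          (overlap P T \<noteq> 1 \<longrightarrow>
             optimal_test (mat 1 - P) \<eta>M \<eta>N Mt Nt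
               (p_failure \<eta>M \<eta>N Mt Nt (restrict_test P T)) (restrict_test P T)) \<and>
          (overlap P T \<noteq> 1 \<and>
           (overlap P T = 0 \<or> pf = 0 \<or>
            p_failure \<eta>M \<eta>N Mt Nt (restrict_test P T) = pf) \<longrightarrow>
             optimal_test (mat 1 - P) \<eta>M \<eta>N Mt Nt pf (restrict_test P T)))"
proof -
  interpret MM: projective_part M Q P
    using povm_M Q P by unfold_locales (auto simp: largest_common_projector_def)
  interpret NN: projective_part N Q P
    using povm_N Q P by unfold_locales (auto simp: largest_common_projector_def)
  let ?R = "mat 1 - P"
  have Mt_eq: "Mt = (\<lambda>j. M j - Q j)" and Nt_eq: "Nt = (\<lambda>j. N j - Q j)"
    by (simp_all add: Mt Nt fun_eq_iff)
  have povm_Mt: "povm ?R Mt" and povm_Nt: "povm ?R Nt"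
    unfolding Mt_eq Nt_eq by (rule MM.povm_remainder NN.povm_remainder)+
  note projP = MM.projector_P
  note projR = projector_complement[OF projP]
  \<comment> \<open>The term \<open>prob c Q T\<close> is common to both measurements.\<close>
  have split: "prob c M T = prob c Mt T + prob c Q T" "prob c N T = prob c Nt T + prob c Q T" for c T
    by (simp_all add: Mt_eq Nt_eq prob_diff)
  have embed: "is_test (mat 1) T"
    "p_success \<eta>M \<eta>N M N T = p_success \<eta>M \<eta>N Mt Nt T"
    "p_failure \<eta>M \<eta>N M N T = p_failure \<eta>M \<eta>N Mt Nt T" if "is_test ?R T" for T
    using that
    by (auto simp: is_test_whole_space p_success_def p_failure_def split MM.prob_Q_complement)
  have Q_weight: "\<eta>M * w + \<eta>N * w = w" for w
    using priors(3) by (metis distrib_right mult_1)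

  \<comment> \<open>Transfer of tests between the two spaces\<close>
  have state: "\<exists>\<sigma>. is_state ?R \<sigma>" if "P \<noteq> mat 1"
    using that by (intro state_exists projR) auto
  have nontrivial: "P \<noteq> mat 1" if "is_test ?R T" for T
    using that by (auto simp: is_test_def acts_on_def)
  have nontrivial': "P \<noteq> mat 1" if "is_test (mat 1) T" "overlap P T \<noteq> 1" for T
    using that by (auto simp: is_test_def overlap_def)

  \<comment> \<open>\<open>T\<close> supplies the weights and \<open>T'\<close> the compressed part;
    the bracketed differences are the share of the range of \<open>P\<close> in the figures of
    \<open>T\<close>. The condition on \<open>l\<close> makes the total trace 1.\<close>
  have pad: "\<exists>F. is_test ?R F \<and>
      p_success \<eta>M \<eta>N Mt Nt F = l * p_success \<eta>M \<eta>N Mt Nt T'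
        + (p_success \<eta>M \<eta>N M N T - p_success \<eta>M \<eta>N Mt Nt T) \<and>
      p_failure \<eta>M \<eta>N Mt Nt F = l * p_failure \<eta>M \<eta>N Mt Nt T'
        + (p_failure \<eta>M \<eta>N M N T - p_failure \<eta>M \<eta>N Mt Nt T)"
    if "P \<noteq> mat 1" "is_test (mat 1) T" "is_test (mat 1) T'" "l \<ge> 0"
      "l * (1 - overlap P T') = 1 - overlap P T" for T T' l
  proof -
    obtain \<sigma> where \<sigma>: "is_state ?R \<sigma>" using state \<open>P \<noteq> mat 1\<close> by blast
    let ?F = "pad_test ?R l (\<lambda>c. prob c Q T) \<sigma> T'"
    have "is_test ?R ?F"
      using that by (intro is_test_pad[OF projP _ \<sigma>])
        (auto simp: MM.prob_Q_nonneg[of "mat 1"] MM.sum_prob_Q[of "mat 1"])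
    then show ?thesis
      by (intro exI[of _ ?F])
        (simp add: p_success_def p_failure_def prob_pad[OF projR povm_Mt \<sigma>]
          prob_pad[OF projR povm_Nt \<sigma>] split algebra_simps)
  qed
  have fill: "\<exists>F. is_test ?R F \<and>
      p_success \<eta>M \<eta>N Mt Nt F = p_success \<eta>M \<eta>N M N T \<and>
      p_failure \<eta>M \<eta>N Mt Nt F = p_failure \<eta>M \<eta>N M N T"
    if "P \<noteq> mat 1" "is_test (mat 1) T" for T
    using pad[OF that that(2), of 1] by simp

  have lift: "optimal_test (mat 1) \<eta>M \<eta>N M N pf Tt" if "optimal_test ?R \<eta>M \<eta>N Mt Nt pf Tt" for pf Tt
    unfolding optimal_test_def
  proof (intro conjI allI impI)
    have Tt: "is_test ?R Tt" using that by (simp add: optimal_test_def)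
    show "is_test (mat 1) Tt" "p_failure \<eta>M \<eta>N M N Tt = pf"
      using that embed[OF Tt] by (simp_all add: optimal_test_def)
    \<comment> \<open>\<open>fill\<close> turns any competitor on the whole space into a reduced
      test with the same figures, which cannot beat \<open>Tt\<close>.\<close>
    fix T assume "is_test (mat 1) T \<and> p_failure \<eta>M \<eta>N M N T = pf"
    then show "p_success \<eta>M \<eta>N M N T \<le> p_success \<eta>M \<eta>N M N Tt"
      using fill[OF nontrivial[OF Tt], of T] that embed[OF Tt]
      by (auto simp: optimal_test_def)
  qed

  have same: "p_success \<eta>M \<eta>N M N T = p_success \<eta>M \<eta>N Mt Nt Tt \<and>
      p_error \<eta>M \<eta>N M N T = p_error \<eta>M \<eta>N Mt Nt Tt"
    if T: "optimal_test (mat 1) \<eta>M \<eta>N M N pf T" and Tt: "optimal_test ?R \<eta>M \<eta>N Mt Nt pf Tt"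
    for pf T Tt
  proof -
    have tests: "is_test (mat 1) T" "is_test ?R Tt"
      using T Tt by (simp_all add: optimal_test_def)
    \<comment> \<open>By \<open>lift\<close>, \<open>T\<close> and \<open>Tt\<close> are two optima
      of one problem.\<close>
    have "p_success \<eta>M \<eta>N M N T = p_success \<eta>M \<eta>N M N Tt"
      using T lift[OF Tt] by (force simp: optimal_test_def intro: order_antisym)
    then have s: "p_success \<eta>M \<eta>N M N T = p_success \<eta>M \<eta>N Mt Nt Tt"
      by (simp add: embed tests)
    moreover have "projector (mat 1 :: 'd cmat)"
      by (simp add: projector_def)
    ultimately show ?thesis
      using p_sum[OF tests(1) _ povm_M povm_N priors(3)]
        p_sum[OF tests(2) projR povm_Mt povm_Nt priors(3)] T Tt
      by (auto simp: optimal_test_def)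
  qed

  \<comment> \<open>Restriction of tests and its optimality\<close>
  have restrict: "restrict_test P Tt = Tt" "overlap P Tt \<noteq> 1" if "is_test ?R Tt" for Tt
    using that by (auto simp: restrict_test_def overlap_complement[OF projP] is_test_def acts_on_def)

  have restrict_test: "is_test ?R (restrict_test P T)"
    "p_success \<eta>M \<eta>N M N T = (1 - overlap P T) * p_success \<eta>M \<eta>N Mt Nt (restrict_test P T)
      + (p_success \<eta>M \<eta>N M N T - p_success \<eta>M \<eta>N Mt Nt T)"
    "p_failure \<eta>M \<eta>N M N T = (1 - overlap P T) * p_failure \<eta>M \<eta>N Mt Nt (restrict_test P T)
      + (p_failure \<eta>M \<eta>N M N T - p_failure \<eta>M \<eta>N Mt Nt T)"
    if T: "is_test (mat 1) T" and ov: "overlap P T \<noteq> 1" for T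
  proof -
    obtain \<sigma> where \<sigma>: "is_state ?R \<sigma>" using state nontrivial'[OF T ov] by blast
    have less: "1 - overlap P T > 0"
      using overlap_le_1[OF projP T] ov by simp
    then show "is_test ?R (restrict_test P T)"
      unfolding restrict_test_eq_pad[of P T \<sigma>] by (intro is_test_pad projP T \<sigma>) auto
    have "(1 - overlap P T) * prob c A (restrict_test P T) = prob c A T" if "povm ?R A" for A c
      unfolding restrict_test_eq_pad[of P T \<sigma>] prob_pad[OF projR that \<sigma>] using less by simp
    then have *: "(1 - overlap P T) * (r * prob c A (restrict_test P T) + s * prob c' B (restrict_test P T))
        = r * prob c A T + s * prob c' B T" if "povm ?R A" "povm ?R B" for A B c c' r s
      using that by (simp add: distrib_left mult.left_commute[of "1 - overlap P T"])
    show "p_success \<eta>M \<eta>N M N T = (1 - overlap P T) * p_success \<eta>M \<eta>N Mt Nt (restrict_test P T)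
      + (p_success \<eta>M \<eta>N M N T - p_success \<eta>M \<eta>N Mt Nt T)"
      by (simp add: p_success_def[of _ _ Mt Nt] *[OF povm_Mt povm_Nt])
    show "p_failure \<eta>M \<eta>N M N T = (1 - overlap P T) * p_failure \<eta>M \<eta>N Mt Nt (restrict_test P T)
      + (p_failure \<eta>M \<eta>N M N T - p_failure \<eta>M \<eta>N Mt Nt T)"
      by (simp add: p_failure_def[of _ _ Mt Nt] *[OF povm_Mt povm_Nt])
  qed

  have exists: "\<exists>Tt. optimal_test ?R \<eta>M \<eta>N Mt Nt pf Tt"
    if T: "optimal_test (mat 1) \<eta>M \<eta>N M N pf T" and P1: "P \<noteq> mat 1" for pf T
  proof -
    obtain F where F: "is_test ?R F" "p_success \<eta>M \<eta>N Mt Nt F = p_success \<eta>M \<eta>N M N T"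
      "p_failure \<eta>M \<eta>N Mt Nt F = p_failure \<eta>M \<eta>N M N T"
      using fill[OF P1] T by (auto simp: optimal_test_def)
    have "optimal_test ?R \<eta>M \<eta>N Mt Nt pf F"
      unfolding optimal_test_def
    proof (intro conjI allI impI)
      show "is_test ?R F" "p_failure \<eta>M \<eta>N Mt Nt F = pf"
        using F T by (simp_all add: optimal_test_def)
      fix T' assume "is_test ?R T' \<and> p_failure \<eta>M \<eta>N Mt Nt T' = pf"
      then show "p_success \<eta>M \<eta>N Mt Nt T' \<le> p_success \<eta>M \<eta>N Mt Nt F"
        using T embed[of T'] F(2) unfolding optimal_test_def by metis
    qed
    then show ?thesis ..
  qed

  have optimal_restrict: "optimal_test ?R \<eta>M \<eta>N Mt Nt
      (p_failure \<eta>M \<eta>N Mt Nt (restrict_test P T)) (restrict_test P T)"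
    if opt: "optimal_test (mat 1) \<eta>M \<eta>N M N pf T" and ov: "overlap P T \<noteq> 1" for pf T
    unfolding optimal_test_def
  proof (intro conjI allI impI)
    have T: "is_test (mat 1) T" using opt by (simp add: optimal_test_def)
    note r = restrict_test[OF T ov]
    show "is_test ?R (restrict_test P T)" by (rule r)
    have less: "1 - overlap P T > 0"
      using overlap_le_1[OF projP T] ov by simp
    fix T' assume T': "is_test ?R T' \<and> p_failure \<eta>M \<eta>N Mt Nt T'
      = p_failure \<eta>M \<eta>N Mt Nt (restrict_test P T)"
    \<comment> \<open>A reduced test has overlap 0, so the factor demanded by \<open>pad\<close> is
      \<open>1 - overlap P T\<close>. Then \<open>F\<close> differs from \<open>T\<close> in its
      figures only by having \<open>T'\<close> in place of the restriction.\<close>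
    obtain F where F: "is_test ?R F" "p_success \<eta>M \<eta>N Mt Nt F
        = (1 - overlap P T) * p_success \<eta>M \<eta>N Mt Nt T'
          + (p_success \<eta>M \<eta>N M N T - p_success \<eta>M \<eta>N Mt Nt T)"
      "p_failure \<eta>M \<eta>N Mt Nt F = (1 - overlap P T) * p_failure \<eta>M \<eta>N Mt Nt T'
        + (p_failure \<eta>M \<eta>N M N T - p_failure \<eta>M \<eta>N Mt Nt T)"
      using pad[OF nontrivial'[OF T ov] T, of T' "1 - overlap P T"] T' less
      by (auto simp: embed overlap_complement[OF projP])
    have "p_failure \<eta>M \<eta>N M N F = pf"
      using F(3) r(3) T' opt by (simp add: embed[OF F(1)] optimal_test_def)
    then have "p_success \<eta>M \<eta>N M N F \<le> p_success \<eta>M \<eta>N M N T"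
      using opt embed(1)[OF F(1)] by (simp add: optimal_test_def)
    then have "(1 - overlap P T) * p_success \<eta>M \<eta>N Mt Nt T'
        \<le> (1 - overlap P T) * p_success \<eta>M \<eta>N Mt Nt (restrict_test P T)"
      using F(2) r(2) by (simp add: embed[OF F(1)])
    then show "p_success \<eta>M \<eta>N Mt Nt T' \<le> p_success \<eta>M \<eta>N Mt Nt (restrict_test P T)"
      using less by simp
  qed simp

  have failure_restrict: "p_failure \<eta>M \<eta>N Mt Nt (restrict_test P T) = pf"
    if opt: "optimal_test (mat 1) \<eta>M \<eta>N M N pf T" and ov: "overlap P T \<noteq> 1"
      and cases: "overlap P T = 0 \<or> pf = 0" for pf T
  proof -
    have T: "is_test (mat 1) T" and pf: "p_failure \<eta>M \<eta>N M N T = pf"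
      using opt by (simp_all add: optimal_test_def)
    note r = restrict_test[OF T ov]
    have diff: "p_failure \<eta>M \<eta>N M N T - p_failure \<eta>M \<eta>N Mt Nt T = prob Conc_fail Q T"
      using Q_weight[of "prob Conc_fail Q T"] by (simp only: p_failure_def split distrib_left)
    note nn = MM.prob_Q_nonneg[OF T]
    show ?thesis
      using cases
    proof
      assume "overlap P T = 0"
      then have "prob Conc_fail Q T = 0"
        using MM.sum_prob_Q[OF T] nn[of Conc_M] nn[of Conc_N] nn[of Conc_fail] by linarith
      then show ?thesis
        using r(3) diff pf \<open>overlap P T = 0\<close> by simp
    next
      \<comment> \<open>\<open>pf\<close> is a sum of two nonnegative terms, the scaled failure rate
        of the restriction and the failure weight on \<open>Q\<close>; both vanish.\<close>
      assume "pf = 0"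
      have "p_failure \<eta>M \<eta>N Mt Nt (restrict_test P T) \<ge> 0"
        using prob_nonneg[OF r(1)] povm_Mt povm_Nt priors(1,2) by (simp add: p_failure_def povm_def)
      moreover have "(1 - overlap P T) * p_failure \<eta>M \<eta>N Mt Nt (restrict_test P T) \<le> 0"
        using r(3) diff pf nn[of Conc_fail] \<open>pf = 0\<close> by linarith
      moreover have "1 - overlap P T > 0"
        using overlap_le_1[OF projP T] ov by simp
      ultimately show ?thesis
        using \<open>pf = 0\<close> by (simp add: mult_le_0_iff)
    qed
  qed

  have restricted: "optimal_test ?R \<eta>M \<eta>N Mt Nt pf (restrict_test P T)"
    if "optimal_test (mat 1) \<eta>M \<eta>N M N pf T" "overlap P T \<noteq> 1"
      "overlap P T = 0 \<or> pf = 0 \<or> p_failure \<eta>M \<eta>N Mt Nt (restrict_test P T) = pf" for pf T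
    using optimal_restrict[OF that(1,2)] failure_restrict[OF that(1,2)] that(3) by auto
  \<comment> \<open>\<open>Tt\<close> read on the whole space is its own extension, as its overlap
    with \<open>P\<close> is 0.\<close>
  have extension: "\<exists>T. optimal_test (mat 1) \<eta>M \<eta>N M N pf T \<and> overlap P T \<noteq> 1 \<and> restrict_test P T = Tt"
    if "optimal_test ?R \<eta>M \<eta>N Mt Nt pf Tt" for pf Tt
    using lift[OF that] restrict[of Tt] that by (auto simp: optimal_test_def)
  show ?thesis
    by (intro conjI allI impI; (elim conjE)?)
      (assumption | rule MM.Q_orthogonal projP povm_Mt povm_Nt extension exists optimal_restrict
        restricted same[THEN conjunct1] same[THEN conjunct2])+
qed

end
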